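(* Let $X$ be a Banach space and let $A\subset X\times X^*$ be nonempty. Then $A$ is representable if and only if its Penot function $\varphi_A$ is a representative of $A$.
   Context: $X$ is a real Banach space with dual $X^*$; multi-valued operators $A:X\rightrightarrows X^*$ are identified with their graphs in $Z:=X\times X^*$. Write $p(x,x^* )=x^*(x)$ and, for $z=(x,x^* )$, $w=(y,y^* )$ in $Z$, $z\cdot w=x^*(y)+y^*(x)$. $Z$ carries a topology compatible with this natural duality $(Z,Z)$, e.g. the strong$\times$weak-star topology; lower semicontinuity is understood with respect to it. For $f:Z\to\mathbb{R}\cup\{\infty\}$ the convex conjugate is $f^*(w)=\sup\{w\cdot z-f(z): z\in Z\}$, $w\in Z$. For $\emptyset\ne A\subset Z$, let $p_A=p+i_A$, where $i_A=0$ on $A$ and $i_A=+\infty$ off $A$. The Fitzpatrick function of $A$ is $h_A=p_A^*$, i.e. $h_A(z)=\sup_{a\in A}\{z\cdot a-p(a)\}$. The Penot function of $A$ is $\varphi_A=h_A^*=\operatorname{cl}\operatorname{co}p_A$, the greatest proper convex lower semicontinuous function majorized by $p_A$. $A$ is representable if there is a proper convex lower semicontinuous $h:Z\to\mathbb{R}\cup\{\infty\}$ with (i) $h(z)\ge p(z)$ for every $z\in Z$ and (ii) $z\in A$ iff $h(z)=p(z)$; such an $h$ is called a representative of $A$. *)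

theory Defs
  imports "HOL-Analysis.Analysis"
begin

text \<open>Throughout, \<open>Z = X \<times> X\<^sup>*\<close> is the type \<^typ>\<open>'a \<times> ('a \<Rightarrow>\<^sub>L real)\<close> with \<open>'a\<close> the Banach
  space \<open>X\<close>.\<close>

type_synonym 'a dpair = "'a \<times> ('a \<Rightarrow>\<^sub>L real)"

definition duality :: "'a::real_normed_vector dpair \<Rightarrow> real" where
  "duality z = blinfun_apply (snd z) (fst z)"

definition pairing :: "'a::real_normed_vector dpair \<Rightarrow> 'a dpair \<Rightarrow> real" where
  "pairing z w = blinfun_apply (snd z) (fst w) + blinfun_apply (snd w) (fst z)"

text \<open>The topology on \<open>Z\<close> is a parameter, because the type already carries the norm topology, which
  need not be compatible with the natural duality.  Separation need not be demanded: every
  \<open>pairing w\<close> is continuous and these functionals separate points.\<close>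

definition locally_convex_topology :: "'b::real_vector topology \<Rightarrow> bool" where
  "locally_convex_topology T \<longleftrightarrow>
     topspace T = UNIV \<and>
     continuous_map (prod_topology T T) T (\<lambda>(z, w). z + w) \<and>
     continuous_map (prod_topology euclideanreal T) T (\<lambda>(c, z). c *\<^sub>R z) \<and>
     (\<forall>U. openin T U \<and> 0 \<in> U \<longrightarrow> (\<exists>V. openin T V \<and> convex V \<and> 0 \<in> V \<and> V \<subseteq> U))"

definition duality_compatible :: "'a::real_normed_vector dpair topology \<Rightarrow> bool" where
  "duality_compatible T \<longleftrightarrow>
     locally_convex_topology T \<and>
     (\<forall>\<phi>. linear \<phi> \<longrightarrow> (continuous_map T euclideanreal \<phi> \<longleftrightarrow> (\<exists>w. \<forall>z. \<phi> z = pairing z w)))"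

definition proper_fun :: "('b \<Rightarrow> ereal) \<Rightarrow> bool" where
  "proper_fun f \<longleftrightarrow> (\<forall>z. f z \<noteq> -\<infinity>) \<and> (\<exists>z. f z \<noteq> \<infinity>)"

text \<open>In \<^typ>\<open>ereal\<close>, \<open>\<infinity> + (- \<infinity>) = \<infinity>\<close> and \<open>0 * \<infinity> = 0\<close>; convexity is only used for functions that
  are also required to be proper, for which the former case does not arise.\<close>

definition convex_fun :: "('b::real_vector \<Rightarrow> ereal) \<Rightarrow> bool" where
  "convex_fun f \<longleftrightarrow>
     (\<forall>x y. \<forall>u\<ge>0. \<forall>v\<ge>0. u + v = 1 \<longrightarrow>
        f (u *\<^sub>R x + v *\<^sub>R y) \<le> ereal u * f x + ereal v * f y)"

definition lsc_fun :: "'b topology \<Rightarrow> ('b \<Rightarrow> ereal) \<Rightarrow> bool" where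
  "lsc_fun T f \<longleftrightarrow> (\<forall>r::real. openin T {z \<in> topspace T. ereal r < f z})"

definition conjugate_fun :: "('a::real_normed_vector dpair \<Rightarrow> ereal) \<Rightarrow> 'a dpair \<Rightarrow> ereal" where
  "conjugate_fun f w = (SUP z. ereal (pairing w z) - f z)"

definition indicator_fun :: "'b set \<Rightarrow> 'b \<Rightarrow> ereal" where
  "indicator_fun A z = (if z \<in> A then 0 else \<infinity>)"

definition duality_on :: "'a::real_normed_vector dpair set \<Rightarrow> 'a dpair \<Rightarrow> ereal" where
  "duality_on A z = ereal (duality z) + indicator_fun A z"

definition fitzpatrick_fun :: "'a::real_normed_vector dpair set \<Rightarrow> 'a dpair \<Rightarrow> ereal" where
  "fitzpatrick_fun A = conjugate_fun (duality_on A)"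

text \<open>The Penot function is the biconjugate of \<open>duality_on A\<close>.  By biconjugation it is the greatest
  proper convex lower semicontinuous minorant of \<open>duality_on A\<close> whenever one exists; otherwise it is
  identically \<open>- \<infinity>\<close> (for nonempty \<open>A\<close>).\<close>

definition penot_fun :: "'a::real_normed_vector dpair set \<Rightarrow> 'a dpair \<Rightarrow> ereal" where
  "penot_fun A = conjugate_fun (fitzpatrick_fun A)"

definition representative ::
  "'a::real_normed_vector dpair topology \<Rightarrow> ('a dpair \<Rightarrow> ereal) \<Rightarrow> 'a dpair set \<Rightarrow> bool" where
  "representative T h A \<longleftrightarrow>
     proper_fun h \<and> convex_fun h \<and> lsc_fun T h \<and>
     (\<forall>z. ereal (duality z) \<le> h z) \<and>
     (\<forall>z. z \<in> A \<longleftrightarrow> h z = ereal (duality z))"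

definition representable ::
  "'a::real_normed_vector dpair topology \<Rightarrow> 'a dpair set \<Rightarrow> bool" where
  "representable T A \<longleftrightarrow> (\<exists>h. representative T h A)"


lemma fitzpatrick_fun_eq: "fitzpatrick_fun A z = (SUP a\<in>A. ereal (pairing z a - duality a))"
proof (rule antisym)
  show "fitzpatrick_fun A z \<le> (SUP a\<in>A. ereal (pairing z a - duality a))"
    unfolding fitzpatrick_fun_def conjugate_fun_def
  proof (rule SUP_least)
    fix a
    show "ereal (pairing z a) - duality_on A a \<le> (SUP a\<in>A. ereal (pairing z a - duality a))"
      by (cases "a \<in> A") (auto simp: duality_on_def indicator_fun_def intro: SUP_upper2)
  qed
  show "(SUP a\<in>A. ereal (pairing z a - duality a)) \<le> fitzpatrick_fun A z"
    unfolding fitzpatrick_fun_def conjugate_fun_def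
  proof (rule SUP_least)
    fix a assume "a \<in> A"
    then show "ereal (pairing z a - duality a) \<le> (SUP a. ereal (pairing z a) - duality_on A a)"
      by (intro SUP_upper2[of a]) (auto simp: duality_on_def indicator_fun_def)
  qed
qed


text \<open>The strong \<open>\<times>\<close> weak-star topology is compatible with the duality.  On \<^typ>\<open>'a \<Rightarrow>\<^sub>L real\<close> the
  library's \<^const>\<open>strong_operator_topology\<close> is pointwise convergence, i.e. the weak-star topology.\<close>

lemma linear_functional_finite_combination:
  fixes g :: "'b::real_vector \<Rightarrow> real" and L :: "'i \<Rightarrow> 'b \<Rightarrow> real"
  assumes "finite I" "linear g" "\<And>i. linear (L i)" "subspace S"
    and "\<And>f. f \<in> S \<Longrightarrow> (\<forall>i\<in>I. L i f = 0) \<Longrightarrow> g f = 0"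
  shows "\<exists>c. \<forall>f\<in>S. g f = (\<Sum>i\<in>I. c i * L i f)"
  using assms(1,4,5)
proof (induction I arbitrary: S rule: finite_induct)
  case empty
  then show ?case by auto
next
  case (insert j I)
  have lin: "L i (x - t *\<^sub>R y) = L i x - t * L i y" "g (x - t *\<^sub>R y) = g x - t * g y" for i x y t
    using assms(2,3) by (simp_all add: linear_diff linear_scale)
  define S' where "S' = S \<inter> {f. L j f = 0}"
  have "subspace S'"
    unfolding S'_def using insert.prems(1) linear_subspace_kernel[OF assms(3)]
    by (intro subspace_inter)
  moreover have "f \<in> S' \<Longrightarrow> (\<forall>i\<in>I. L i f = 0) \<Longrightarrow> g f = 0" for f
    using insert.prems(2)[of f] by (auto simp: S'_def)
  ultimately obtain c where c: "\<forall>f\<in>S'. g f = (\<Sum>i\<in>I. c i * L i f)"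
    using insert.IH[of S'] by blast
  show ?case
  proof (cases "\<exists>u\<in>S. L j u \<noteq> 0")
    case False
    then have "\<forall>f\<in>S. g f = (\<Sum>i\<in>insert j I. c i * L i f)"
      using c insert.hyps by (auto simp: S'_def)
    then show ?thesis by blast
  next
    case True
    then obtain u where u: "u \<in> S" "L j u \<noteq> 0" by blast
    define d where "d = (g u - (\<Sum>i\<in>I. c i * L i u)) / L j u"
    have "g f = (\<Sum>i\<in>insert j I. (c(j := d)) i * L i f)" if f: "f \<in> S" for f
    proof -
      define t where "t = L j f / L j u"
      have "f - t *\<^sub>R u \<in> S"
        using f u insert.prems(1) by (simp add: subspace_diff subspace_scale)
      then have "f - t *\<^sub>R u \<in> S'"
        using u by (simp add: S'_def lin t_def)
      then have "g f - t * g u = (\<Sum>i\<in>I. c i * (L i f - t * L i u))"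
        using c by (auto simp: lin[symmetric])
      also have "\<dots> = (\<Sum>i\<in>I. c i * L i f) - t * (\<Sum>i\<in>I. c i * L i u)"
        by (simp add: right_diff_distrib sum_subtractf sum_distrib_left mult.left_commute)
      finally have "g f = (\<Sum>i\<in>I. c i * L i f) + d * L j f"
        using u by (simp add: d_def t_def field_simps)
      moreover have "(\<Sum>i\<in>I. (c(j := d)) i * L i f) = (\<Sum>i\<in>I. c i * L i f)"
        using insert.hyps by (intro sum.cong) auto
      ultimately show ?thesis
        using insert.hyps by simp
    qed
    then show ?thesis by blast
  qed
qed

lemma weak_star_neighbourhood:
  fixes U :: "('a::real_normed_vector \<Rightarrow>\<^sub>L real) set"
  assumes "openin strong_operator_topology U" "0 \<in> U"
  obtains I e where "finite I" "0 < e" "{f. \<forall>x\<in>I. \<bar>blinfun_apply f x\<bar> < e} \<subseteq> U"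
proof -
  obtain W :: "('a \<Rightarrow> real) set" where W: "open W" "U = blinfun_apply -` W"
    using assms(1) unfolding strong_operator_topology_def
    by (auto simp: openin_pullback_topology)
  have "openin (product_topology (\<lambda>i::'a. euclidean) UNIV) W"
    using W(1) unfolding open_fun_def .
  moreover have "(\<lambda>x. 0) \<in> W"
    using assms(2) W(2) by (simp add: zero_blinfun.rep_eq)
  ultimately obtain X where X: "(\<lambda>x. 0) \<in> (\<Pi>\<^sub>E i\<in>UNIV. X i)" "\<And>i. openin euclidean (X i)"
      "finite {i. X i \<noteq> topspace euclidean}" "(\<Pi>\<^sub>E i\<in>UNIV. X i) \<subseteq> W"
    using product_topology_open_contains_basis[of "\<lambda>i::'a. euclidean::real topology" UNIV W]
    by blast
  define I where "I = {i. X i \<noteq> UNIV}"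
  have fin: "finite I" using X(3) by (simp add: I_def)
  have "\<exists>e>0. ball 0 e \<subseteq> X i" for i
    using X(1) X(2)[of i] open_contains_ball[of "X i"] by auto
  then obtain e where e: "\<And>i. e i > 0" "\<And>i. ball 0 (e i) \<subseteq> X i" by metis
  define d where "d = Min (insert 1 (e ` I))"
  have d: "0 < d" "\<And>i. i \<in> I \<Longrightarrow> d \<le> e i"
    using fin e(1) by (auto simp: d_def)
  have "{f. \<forall>x\<in>I. \<bar>blinfun_apply f x\<bar> < d} \<subseteq> U"
  proof
    fix f :: "'a \<Rightarrow>\<^sub>L real" assume f: "f \<in> {f. \<forall>x\<in>I. \<bar>blinfun_apply f x\<bar> < d}"
    have "blinfun_apply f i \<in> X i" for i
    proof (cases "i \<in> I")
      case True
      then have "blinfun_apply f i \<in> ball 0 (e i)" using f d(2)[of i] by fastforce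
      then show ?thesis using e(2) by blast
    qed (auto simp: I_def)
    then have "blinfun_apply f \<in> W" using X(4) by (auto simp: PiE_UNIV_domain)
    then show "f \<in> U" using W(2) by simp
  qed
  then show thesis using that fin d(1) by blast
qed

lemma strong_weak_star_neighbourhood:
  fixes U :: "'a::real_normed_vector dpair set"
  assumes "openin (prod_topology euclidean strong_operator_topology) U" "0 \<in> U"
  obtains I d e where "finite I" "0 < d" "0 < e"
    "ball 0 d \<times> {f. \<forall>x\<in>I. \<bar>blinfun_apply f x\<bar> < e} \<subseteq> U"
proof -
  obtain V W where VW: "openin euclidean V" "openin strong_operator_topology W"
      "0 \<in> V" "0 \<in> W" "V \<times> W \<subseteq> U"
    using assms unfolding openin_prod_topology_alt by (metis zero_prod_def)
  obtain d where "0 < d" "ball 0 d \<subseteq> V"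
    using VW(1,3) unfolding open_openin[symmetric] open_contains_ball by blast
  moreover obtain I e where "finite I" "0 < e" "{f. \<forall>x\<in>I. \<bar>blinfun_apply f x\<bar> < e} \<subseteq> W"
    using weak_star_neighbourhood[OF VW(2,4)] by blast
  ultimately show thesis using that VW(5) by (meson Sigma_mono subset_trans)
qed

lemma duality_compatible_strong_weak_star:
  "duality_compatible (prod_topology euclidean strong_operator_topology
     :: 'a::real_normed_vector dpair topology)"
proof -
  let ?T = "prod_topology euclidean strong_operator_topology :: 'a dpair topology"
  have top: "topspace ?T = UNIV"
    by (simp add: strong_operator_topology_topspace)
  have cfst: "continuous_map ?T euclidean fst"
    by (rule continuous_map_fst)
  have csnd: "continuous_map ?T euclidean (\<lambda>z. blinfun_apply (snd z) x)" for x
    using continuous_map_compose[OF continuous_map_snd strong_operator_topology_continuous_evaluation[of x]]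
    by (simp add: comp_def)
  have into: "continuous_map S ?T h"
    if "continuous_map S euclidean (\<lambda>s. fst (h s))"
       "\<And>x. continuous_map S euclidean (\<lambda>s. blinfun_apply (snd (h s)) x)"
    for S :: "'s topology" and h
    unfolding continuous_map_componentwise
    using that by (auto simp: continuous_map_pairwise comp_def
        continuous_on_strong_operator_topo_iff_coordinatewise)
  have proj: "continuous_map (prod_topology ?T ?T) euclidean (\<lambda>s. fst (fst s))"
    "continuous_map (prod_topology ?T ?T) euclidean (\<lambda>s. fst (snd s))"
    "continuous_map (prod_topology ?T ?T) euclidean (\<lambda>s. blinfun_apply (snd (fst s)) x)"
    "continuous_map (prod_topology ?T ?T) euclidean (\<lambda>s. blinfun_apply (snd (snd s)) x)" for x
    using continuous_map_compose[OF continuous_map_fst cfst]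
      continuous_map_compose[OF continuous_map_snd cfst]
      continuous_map_compose[OF continuous_map_fst csnd[of x]]
      continuous_map_compose[OF continuous_map_snd csnd[of x]]
    by (simp_all add: comp_def)
  have add: "continuous_map (prod_topology ?T ?T) ?T (\<lambda>(z, w). z + w)"
    unfolding case_prod_unfold
    by (rule into) (auto simp: plus_blinfun.rep_eq intro!: continuous_map_add proj)
  have proj2: "continuous_map (prod_topology euclideanreal ?T) euclidean fst"
    "continuous_map (prod_topology euclideanreal ?T) euclidean (\<lambda>s. fst (snd s))"
    "continuous_map (prod_topology euclideanreal ?T) euclidean (\<lambda>s. blinfun_apply (snd (snd s)) x)" for x
    using continuous_map_compose[OF continuous_map_snd cfst]
      continuous_map_compose[OF continuous_map_snd csnd[of x]]
    by (simp_all add: comp_def continuous_map_fst)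
  have scale: "continuous_map (prod_topology euclideanreal ?T) ?T (\<lambda>(c, z). c *\<^sub>R z)"
    unfolding case_prod_unfold
  proof (rule into)
    have "continuous_map (prod_topology euclideanreal ?T) (prod_topology euclidean euclidean)
        (\<lambda>s. (fst s, fst (snd s)))"
      unfolding continuous_map_paired using proj2(1,2) by blast
    moreover have "continuous_map (prod_topology euclidean euclidean) euclidean
        (\<lambda>p::real \<times> 'a. fst p *\<^sub>R snd p)"
      by (simp add: euclidean_product_topology continuous_intros)
    ultimately have "continuous_map (prod_topology euclideanreal ?T) euclidean
        ((\<lambda>p. fst p *\<^sub>R snd p) \<circ> (\<lambda>s. (fst s, fst (snd s))))"
      by (rule continuous_map_compose)
    then show "continuous_map (prod_topology euclideanreal ?T) euclidean (\<lambda>s. fst (fst s *\<^sub>R snd s))"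
      by (simp add: comp_def)
    show "continuous_map (prod_topology euclideanreal ?T) euclidean
        (\<lambda>s. blinfun_apply (snd (fst s *\<^sub>R snd s)) x)" for x
      using continuous_map_real_mult[OF proj2(1) proj2(3)[of x]]
      by (simp add: scaleR_blinfun.rep_eq)
  qed
  have lc: "\<exists>V. openin ?T V \<and> convex V \<and> 0 \<in> V \<and> V \<subseteq> U" if U: "openin ?T U" "0 \<in> U" for U
  proof -
    obtain I d e where I: "finite I" "0 < d" "0 < e"
        "ball 0 d \<times> {f. \<forall>x\<in>I. \<bar>blinfun_apply f x\<bar> < e} \<subseteq> U"
      using strong_weak_star_neighbourhood[OF U] .
    let ?N = "{f :: 'a \<Rightarrow>\<^sub>L real. \<forall>x\<in>I. blinfun_apply f x \<in> {-e<..<e}}"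
    have N: "?N = {f. \<forall>x\<in>I. \<bar>blinfun_apply f x\<bar> < e}"
      by (auto simp: abs_less_iff minus_less_iff)
    have "openin strong_operator_topology ?N"
      using strong_operator_topology_basis[of I "\<lambda>_. {-e<..<e}" "\<lambda>x. x"] I(1) by simp
    then have "openin ?T (ball 0 d \<times> ?N)"
      by (simp add: openin_prod_Times_iff)
    moreover have "convex ?N"
    proof -
      have "?N = (\<Inter>x\<in>I. (\<lambda>f. blinfun_apply f x) -` {-e<..<e})" by auto
      moreover have "convex ((\<lambda>f :: 'a \<Rightarrow>\<^sub>L real. blinfun_apply f x) -` {-e<..<e})" for x
        by (rule convex_linear_vimage)
          (auto intro!: linearI simp: plus_blinfun.rep_eq scaleR_blinfun.rep_eq)
      ultimately show ?thesis by (simp add: convex_INT)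
    qed
    then have "convex (ball (0::'a) d \<times> ?N)"
      by (intro convex_Times convex_ball)
    moreover have "0 \<in> ball (0::'a) d \<times> ?N"
      using I(2,3) by (simp add: zero_prod_def zero_blinfun.rep_eq)
    ultimately show ?thesis using I(4)
      by (intro exI[of _ "ball 0 d \<times> ?N"]) (simp only: N simp_thms)
  qed
  have dual: "continuous_map ?T euclideanreal \<phi> \<longleftrightarrow> (\<exists>w. \<forall>z. \<phi> z = pairing z w)"
    if lin: "linear \<phi>" for \<phi>
  proof
    assume "\<exists>w. \<forall>z. \<phi> z = pairing z w"
    then obtain w where w: "\<phi> = (\<lambda>z. pairing z w)" by blast
    have "continuous_map euclidean euclidean (blinfun_apply (snd w))"
      by (simp add: linear_continuous_on blinfun.bounded_linear_right)
    from continuous_map_compose[OF cfst this] csnd[of "fst w"]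
    show "continuous_map ?T euclideanreal \<phi>"
      unfolding w pairing_def by (intro continuous_map_add) (simp_all add: comp_def)
  next
    assume cont: "continuous_map ?T euclideanreal \<phi>"
    have split: "\<phi> z = \<phi> (fst z, 0) + \<phi> (0, snd z)" for z
      using linear_add[OF lin, of "(fst z, 0)" "(0, snd z)"] by simp
    have lin1: "linear (\<lambda>x. \<phi> (x, 0))"
      using linear_add[OF lin, of "(_, 0)" "(_, 0)"] linear_scale[OF lin, of _ "(_, 0)"]
      by (intro linearI) auto
    have lin2: "linear (\<lambda>f. \<phi> (0, f))"
      using linear_add[OF lin, of "(0, _)" "(0, _)"] linear_scale[OF lin, of _ "(0, _)"]
      by (intro linearI) auto
    have "openin ?T {z \<in> topspace ?T. \<phi> z \<in> {-1<..<1}}"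
      using cont by (rule openin_continuous_map_preimage) simp
    then have op: "openin ?T {z. \<phi> z \<in> {-1<..<1}}"
      unfolding top by simp
    have "0 \<in> {z. \<phi> z \<in> {-1<..<1}}" using linear_0[OF lin] by simp
    then obtain I d e where I: "finite I" "0 < d" "0 < e"
        "ball 0 d \<times> {f. \<forall>x\<in>I. \<bar>blinfun_apply f x\<bar> < e} \<subseteq> {z. \<phi> z \<in> {-1<..<1}}"
      using strong_weak_star_neighbourhood[OF op] by blast
    have b1: "\<bar>\<phi> (x, 0)\<bar> \<le> 1" if "norm x < d" for x
    proof -
      have "(x, 0) \<in> ball 0 d \<times> {f. \<forall>x\<in>I. \<bar>blinfun_apply f x\<bar> < e}"
        using that I(3) by (simp add: zero_blinfun.rep_eq)
      then have "(x, 0) \<in> {z. \<phi> z \<in> {-1<..<1}}" using I(4) by blast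
      then show ?thesis by auto
    qed
    have "bounded_linear (\<lambda>x. \<phi> (x, 0))"
    proof (intro bounded_linear_intro[where K = "2 / d"])
      fix x
      show "norm (\<phi> (x, 0)) \<le> norm x * (2 / d)"
      proof (cases "x = 0")
        case True
        then show ?thesis using linear_0[OF lin1] by simp
      next
        case False
        have "\<bar>\<phi> ((d / (2 * norm x)) *\<^sub>R x, 0)\<bar> \<le> 1"
          using False I(2) by (intro b1) simp
        then have "d / (2 * norm x) * \<bar>\<phi> (x, 0)\<bar> \<le> 1"
          unfolding linear_scale[OF lin1] using I(2) by (simp add: abs_mult)
        then show ?thesis
          using False I(2) by (simp add: field_simps)
      qed
    qed (use linear_add[OF lin1] linear_scale[OF lin1] in auto)
    then obtain y where y: "\<And>x. \<phi> (x, 0) = blinfun_apply y x"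
      by (metis bounded_linear_Blinfun_apply)
    have "\<phi> (0, f) = 0" if f: "\<forall>x\<in>I. blinfun_apply f x = 0" for f
    proof (rule ccontr)
      assume nz: "\<phi> (0, f) \<noteq> 0"
      have "(0, (2 / \<phi> (0, f)) *\<^sub>R f) \<in> ball 0 d \<times> {f. \<forall>x\<in>I. \<bar>blinfun_apply f x\<bar> < e}"
        using f I(2,3) by (simp add: scaleR_blinfun.rep_eq)
      then have "(0, (2 / \<phi> (0, f)) *\<^sub>R f) \<in> {z. \<phi> z \<in> {-1<..<1}}" using I(4) by blast
      then have "\<phi> (0, (2 / \<phi> (0, f)) *\<^sub>R f) < 1" by simp
      then show False using linear_scale[OF lin2, of "2 / \<phi> (0, f)" f] nz by simp
    qed
    moreover have "linear (\<lambda>f :: 'a \<Rightarrow>\<^sub>L real. blinfun_apply f x)" for x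
      by (auto intro!: linearI simp: plus_blinfun.rep_eq scaleR_blinfun.rep_eq)
    ultimately obtain c where c: "\<And>f. \<phi> (0, f) = (\<Sum>x\<in>I. c x * blinfun_apply f x)"
      using linear_functional_finite_combination[OF I(1) lin2, of "\<lambda>x f. blinfun_apply f x" UNIV]
      by auto
    have "\<phi> z = pairing z (\<Sum>x\<in>I. c x *\<^sub>R x, y)" for z
      by (subst split) (simp add: y c pairing_def blinfun.sum_right blinfun.scaleR_right)
    then show "\<exists>w. \<forall>z. \<phi> z = pairing z w" by blast
  qed
  show ?thesis
    unfolding duality_compatible_def locally_convex_topology_def
    using top add scale lc dual by blast
qed

end

theory Submission
  imports Defs
begin

text \<open>A representative \<open>h\<close> of \<open>A\<close> lies below \<open>duality_on A\<close>, so by the Fenchel-Moreau theorem it also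
  lies below the biconjugate of that function, the Penot function.  Hence the Penot function is
  squeezed between \<open>h\<close> and \<open>duality_on A\<close>, and inherits from \<open>h\<close> that it majorizes the duality and
  touches it exactly on \<open>A\<close>.  For Fenchel-Moreau, lower semicontinuity and convexity provide a minorant
  of \<open>h\<close> of the form \<open>z \<mapsto> r - K q (z - z\<^sub>0)\<close> with \<open>q\<close> a continuous seminorm, and the sandwich
  form of the Hahn-Banach theorem inserts a continuous affine function between it and \<open>h\<close>.\<close>

section \<open>The Hahn-Banach theorem\<close>

text \<open>Homogeneity is only an inequality for positive scalars, because that is what
  constructions by infima deliver; equality follows by using the inverse scalar.\<close>

definition sublinear :: "('b::real_vector \<Rightarrow> real) \<Rightarrow> bool" where
  "sublinear p \<longleftrightarrow> (\<forall>x y. p (x + y) \<le> p x + p y) \<and> (\<forall>c>0. \<forall>x. p (c *\<^sub>R x) \<le> c * p x)"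

lemma sublinear_add: "sublinear p \<Longrightarrow> p (x + y) \<le> p x + p y"
  by (simp add: sublinear_def)

lemma sublinear_scale_pos:
  assumes "sublinear p" "c > 0"
  shows "p (c *\<^sub>R x) = c * p x"
proof (rule antisym)
  show "p (c *\<^sub>R x) \<le> c * p x"
    using assms by (simp add: sublinear_def)
  have "p (inverse c *\<^sub>R (c *\<^sub>R x)) \<le> inverse c * p (c *\<^sub>R x)"
    using assms by (simp only: sublinear_def positive_imp_inverse_positive)
  then show "c * p x \<le> p (c *\<^sub>R x)"
    using assms(2) by (simp add: field_simps)
qed

lemma sublinear_zero: "sublinear p \<Longrightarrow> p 0 = 0"
  using sublinear_scale_pos[of p 2 0] by simp

lemma sublinear_scale: "sublinear p \<Longrightarrow> c \<ge> 0 \<Longrightarrow> p (c *\<^sub>R x) = c * p x"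
  by (cases "c = 0") (simp_all add: sublinear_zero sublinear_scale_pos)

lemma sublinear_uminus: "sublinear p \<Longrightarrow> - p (- x) \<le> p x"
  using sublinear_add[of p x "- x"] by (simp add: sublinear_zero)

lemma sublinear_scaled: "sublinear p \<Longrightarrow> K \<ge> 0 \<Longrightarrow> sublinear (\<lambda>x. K * p x)"
  using mult_left_mono[of "p (_ + _)" "p _ + p _" K]
  by (auto simp: sublinear_def distrib_left sublinear_scale_pos)

text \<open>The sets \<open>R x\<close> are the fibres of a convex cone in the product with the
  reals, and the lower boundary of such a cone is sublinear. Every sublinear functional built below
  arises this way.\<close>

lemma sublinear_Inf_fibres:
  fixes R :: "'b::real_vector \<Rightarrow> real set"
  assumes add: "\<And>x y a b. a \<in> R x \<Longrightarrow> b \<in> R y \<Longrightarrow> a + b \<in> R (x + y)"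
    and scale: "\<And>c x a. c > 0 \<Longrightarrow> a \<in> R x \<Longrightarrow> c * a \<in> R (c *\<^sub>R x)"
    and ne: "\<And>x. R x \<noteq> {}" and bdd: "\<And>x. bdd_below (R x)"
  shows "sublinear (\<lambda>x. Inf (R x))"
  unfolding sublinear_def
proof (intro conjI allI impI)
  fix x y
  have "Inf (R (x + y)) - b \<le> Inf (R x)" if "b \<in> R y" for b
    using cInf_lower[OF add[OF _ that] bdd] by (intro cInf_greatest[OF ne]) (simp add: diff_le_eq)
  then have "Inf (R (x + y)) - Inf (R x) \<le> b" if "b \<in> R y" for b
    using that by (simp add: algebra_simps)
  then have "Inf (R (x + y)) - Inf (R x) \<le> Inf (R y)"
    by (intro cInf_greatest[OF ne])
  then show "Inf (R (x + y)) \<le> Inf (R x) + Inf (R y)" by simp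
next
  fix c :: real and x assume c: "c > 0"
  have "Inf (R (c *\<^sub>R x)) / c \<le> a" if "a \<in> R x" for a
    using cInf_lower[OF scale[OF c that] bdd] c by (simp add: field_simps)
  then have "Inf (R (c *\<^sub>R x)) / c \<le> Inf (R x)"
    by (intro cInf_greatest[OF ne])
  then show "Inf (R (c *\<^sub>R x)) \<le> c * Inf (R x)"
    using c by (simp add: field_simps)
qed

text \<open>For fixed \<open>y\<close>, the infimum over \<open>t >= 0\<close> of
  \<open>m (x + t *\<^sub>R y) - t * m y\<close> is sublinear in \<open>x\<close> and at most
  \<open>m x\<close> (take \<open>t = 0\<close>). By minimality it equals \<open>m x\<close>, and
  \<open>t = 1\<close> then yields superadditivity.\<close>

lemma minimal_sublinear_imp_linear:
  assumes m: "sublinear m" and min: "\<And>f. sublinear f \<Longrightarrow> (\<And>x. f x \<le> m x) \<Longrightarrow> f = m"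
  shows "linear m"
proof -
  have "m x + m y \<le> m (x + y)" for x y
  proof -
    \<comment> \<open>All upper bounds \<open>a\<close> are collected, not just the values, so that
      subadditivity of \<open>m\<close> suffices for closure under addition.\<close>
    define R where "R x = {a. \<exists>t\<ge>0. m (x + t *\<^sub>R y) - t * m y \<le> a}" for x
    have low: "- m (- x) \<le> a" if "a \<in> R x" for a x
    proof -
      obtain t where t: "t \<ge> 0" "m (x + t *\<^sub>R y) - t * m y \<le> a"
        using \<open>a \<in> R x\<close> by (auto simp: R_def)
      have "m (t *\<^sub>R y) \<le> m (x + t *\<^sub>R y) + m (- x)"
        using sublinear_add[OF m, of "x + t *\<^sub>R y" "- x"] by simp
      with t show ?thesis by (simp add: sublinear_scale[OF m])
    qed
    have bdd: "bdd_below (R x)" for x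
      using low by (rule bdd_belowI)
    have mem: "m (x + t *\<^sub>R y) - t * m y \<in> R x" if "t \<ge> 0" for x t
      using that by (auto simp: R_def)
    have sub: "sublinear (\<lambda>x. Inf (R x))"
    proof (rule sublinear_Inf_fibres[OF _ _ _ bdd])
      fix x x' a b assume "a \<in> R x" "b \<in> R x'"
      then obtain t u where t: "t \<ge> 0" "m (x + t *\<^sub>R y) - t * m y \<le> a"
        and u: "u \<ge> 0" "m (x' + u *\<^sub>R y) - u * m y \<le> b"
        by (auto simp: R_def)
      have "m ((x + x') + (t + u) *\<^sub>R y) \<le> m (x + t *\<^sub>R y) + m (x' + u *\<^sub>R y)"
        using sublinear_add[OF m, of "x + t *\<^sub>R y" "x' + u *\<^sub>R y"] by (simp add: algebra_simps)
      then have "m ((x + x') + (t + u) *\<^sub>R y) - (t + u) * m y \<le> a + b"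
        using t u by (simp add: algebra_simps)
      then show "a + b \<in> R (x + x')"
        using t u unfolding R_def by (intro CollectI exI[of _ "t + u"]) simp
    next
      fix c :: real and x a assume c: "c > 0" and "a \<in> R x"
      then obtain t where t: "t \<ge> 0" "m (x + t *\<^sub>R y) - t * m y \<le> a"
        by (auto simp: R_def)
      have "m (c *\<^sub>R x + (c * t) *\<^sub>R y) - (c * t) * m y = c * (m (x + t *\<^sub>R y) - t * m y)"
        using sublinear_scale_pos[OF m c, of "x + t *\<^sub>R y"] by (simp add: algebra_simps)
      also have "\<dots> \<le> c * a" using c t by simp
      finally show "c * a \<in> R (c *\<^sub>R x)"
        using t c unfolding R_def by (intro CollectI exI[of _ "c * t"]) simp
    qed (use mem[of 0] in auto)
    have "Inf (R x) \<le> m x" for x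
      using cInf_lower[OF mem[of 0 x] bdd] by simp
    with min[OF sub] have "Inf (R x) = m x" by metis
    then show ?thesis
      using cInf_lower[OF mem[of 1 x] bdd] by simp
  qed
  then have add: "m (x + y) = m x + m y" for x y
    using sublinear_add[OF m] by (meson antisym)
  have neg: "m (- x) = - m x" for x
    using add[of x "- x"] by (simp add: sublinear_zero[OF m])
  have "m (c *\<^sub>R x) = c * m x" for c x
    using sublinear_scale[OF m, of "\<bar>c\<bar>" x] neg[of "c *\<^sub>R x"] by (cases "c \<ge> 0") simp_all
  with add show ?thesis by (intro linearI) simp_all
qed

theorem hahn_banach:
  fixes p :: "'b::real_vector \<Rightarrow> real"
  assumes p: "sublinear p"
  obtains f where "linear f" "\<And>x. f x \<le> p x"
proof -
  define S where "S = {f. sublinear f \<and> (\<forall>x. f x \<le> p x)}"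
  \<comment> \<open>The order is reversed, so that the maximal element given by Zorn's lemma is a
    minimal sublinear functional below \<open>p\<close>.\<close>
  define P where "P f g \<longleftrightarrow> (\<forall>x. g x \<le> f x)" for f g :: "'b \<Rightarrow> real"
  have "\<exists>m\<in>S. \<forall>a\<in>S. P m a \<longrightarrow> a = m"
  proof (rule predicate_Zorn)
    show "partial_order_on S (relation_of P S)"
      by (rule partial_order_on_relation_ofI) (auto simp: P_def fun_eq_iff intro: order_trans antisym)
  next
    fix C assume C: "C \<in> Chains (relation_of P S)"
    then have CS: "C \<subseteq> S" by (rule Chains_relation_of)
    have chain: "(\<forall>x. f x \<le> g x) \<or> (\<forall>x. g x \<le> f x)" if "f \<in> C" "g \<in> C" for f g
      using C that by (auto simp: Chains_def relation_of_def P_def)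
    show "\<exists>u\<in>S. \<forall>a\<in>C. P a u"
    proof (cases "C = {}")
      case True
      then show ?thesis using p by (auto simp: S_def)
    next
      case False
      define R where "R x = {a. \<exists>f\<in>C. f x \<le> a}" for x
      \<comment> \<open>A lower bound independent of \<open>f\<close> keeps the pointwise infimum
        over the chain finite.\<close>
      have "- p (- x) \<le> f x" if "f \<in> C" for f x
      proof -
        have f: "sublinear f" "f (- x) \<le> p (- x)" using that CS by (auto simp: S_def)
        then show ?thesis using sublinear_uminus[OF f(1), of x] by linarith
      qed
      then have bdd: "bdd_below (R x)" for x
        by (intro bdd_belowI[of _ "- p (- x)"]) (fastforce simp: R_def intro: order_trans)
      have lower: "Inf (R x) \<le> f x" if "f \<in> C" for f x
        by (rule cInf_lower[OF _ bdd]) (use that in \<open>auto simp: R_def\<close>)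
      have "sublinear (\<lambda>x. Inf (R x))"
      proof (rule sublinear_Inf_fibres[OF _ _ _ bdd])
        fix x y a b assume "a \<in> R x" "b \<in> R y"
        then obtain f g where fg: "f \<in> C" "g \<in> C" "f x \<le> a" "g y \<le> b" by (auto simp: R_def)
        \<comment> \<open>The smaller of the two comparable functionals serves at both points; for a
          family that is not directed the infimum could fail to be subadditive.\<close>
        then obtain k where k: "k \<in> C" "k x \<le> a" "k y \<le> b"
          using chain[OF fg(1,2)] by (meson order_trans)
        then have "sublinear k" using CS by (auto simp: S_def)
        then have "k (x + y) \<le> a + b" using sublinear_add[of k x y] k by linarith
        then show "a + b \<in> R (x + y)" using k by (auto simp: R_def)
      next
        fix c :: real and x a assume c: "c > 0" and "a \<in> R x"
        then obtain f where f: "f \<in> C" "f x \<le> a" by (auto simp: R_def)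
        then have "sublinear f" using CS by (auto simp: S_def)
        then have "f (c *\<^sub>R x) \<le> c * a" using c f by (simp add: sublinear_scale_pos)
        then show "c * a \<in> R (c *\<^sub>R x)" using f by (auto simp: R_def)
      qed (use False in \<open>auto simp: R_def\<close>)
      moreover have "Inf (R x) \<le> p x" for x
      proof -
        obtain f where "f \<in> C" using False by blast
        then have "f x \<le> p x" using CS by (auto simp: S_def)
        then show ?thesis using lower[OF \<open>f \<in> C\<close>, of x] by linarith
      qed
      ultimately have "(\<lambda>x. Inf (R x)) \<in> S" by (simp add: S_def)
      moreover have "\<forall>a\<in>C. P a (\<lambda>x. Inf (R x))" using lower by (simp add: P_def)
      ultimately show ?thesis by blast
    qed
  qed
  then obtain m where m: "m \<in> S" "\<And>a. a \<in> S \<Longrightarrow> (\<And>x. a x \<le> m x) \<Longrightarrow> a = m"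
    by (auto simp: P_def)
  have "linear m"
  proof (rule minimal_sublinear_imp_linear)
    show "sublinear m" using m(1) by (simp add: S_def)
    fix f assume f: "sublinear f" "\<And>x. f x \<le> m x"
    then have "f \<in> S" using m(1) by (auto simp: S_def intro: order_trans)
    then show "f = m" using f m(2) by blast
  qed
  then show thesis using that m(1) by (auto simp: S_def)
qed

text \<open>The sublinear functional to which Hahn-Banach is applied is the infimal convolution of \<open>q\<close>
  with the conical hull of \<open>v \<mapsto> g (z\<^sub>0 + v) - s\<close>.\<close>

lemma hahn_banach_sandwich:
  fixes g :: "'b::real_vector \<Rightarrow> real"
  assumes g: "convex_on D g" and "D \<noteq> {}" and q: "sublinear q"
    and le: "\<And>z. z \<in> D \<Longrightarrow> s \<le> g z + q (z0 - z)"
  obtains f where "linear f" "\<And>v. f v \<le> q v" "\<And>z. z \<in> D \<Longrightarrow> s + f (z - z0) \<le> g z"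
proof -
  define R where
    "R v = {a. \<exists>l\<ge>0. \<exists>z\<in>D. l * (g z - s) + q (v - l *\<^sub>R (z - z0)) \<le> a}" for v
  have bdd: "bdd_below (R v)" for v
  proof (rule bdd_belowI)
    fix a assume "a \<in> R v"
    then obtain l z where lz: "l \<ge> 0" "z \<in> D" "l * (g z - s) + q (v - l *\<^sub>R (z - z0)) \<le> a"
      by (auto simp: R_def)
    \<comment> \<open>Combined with \<open>le\<close> multiplied by \<open>l\<close>, this bounds
      the members of \<open>R v\<close> below independently of \<open>l\<close> and
      \<open>z\<close>.\<close>
    have "q (l *\<^sub>R (z0 - z)) \<le> q (v - l *\<^sub>R (z - z0)) + q (- v)"
      using sublinear_add[OF q, of "v - l *\<^sub>R (z - z0)" "- v"] by (simp add: algebra_simps)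
    moreover have "l * s \<le> l * (g z + q (z0 - z))"
      using lz le by (intro mult_left_mono)
    ultimately show "- q (- v) \<le> a"
      using lz by (simp add: sublinear_scale[OF q lz(1)] right_diff_distrib distrib_left)
  qed
  have mem: "l * (g z - s) + q (v - l *\<^sub>R (z - z0)) \<in> R v" if "l \<ge> 0" "z \<in> D" for l z v
    using that by (auto simp: R_def)
  obtain z1 where z1: "z1 \<in> D" using \<open>D \<noteq> {}\<close> by blast
  have "sublinear (\<lambda>v. Inf (R v))"
  proof (rule sublinear_Inf_fibres[OF _ _ _ bdd])
    fix v w a b assume "a \<in> R v" "b \<in> R w"
    then obtain l y k z where ly: "l \<ge> 0" "y \<in> D" "l * (g y - s) + q (v - l *\<^sub>R (y - z0)) \<le> a"
      and kz: "k \<ge> 0" "z \<in> D" "k * (g z - s) + q (w - k *\<^sub>R (z - z0)) \<le> b"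
      by (auto simp: R_def)
    \<comment> \<open>Convexity of \<open>g\<close> merges the two cone elements into one with
      weight \<open>l + k\<close>, at the weighted mean of \<open>y\<close> and \<open>z\<close>. If
      both weights vanish, any point of \<open>D\<close> will do.\<close>
    obtain x where x: "x \<in> D" "(l + k) *\<^sub>R x = l *\<^sub>R y + k *\<^sub>R z"
      "(l + k) * g x \<le> l * g y + k * g z"
    proof (cases "l + k = 0")
      case True
      then have "l = 0" "k = 0" using ly kz by auto
      then show thesis using that[OF ly(2)] by simp
    next
      case False
      then have pos: "l + k > 0" using ly kz by auto
      define x where "x = (l / (l + k)) *\<^sub>R y + (k / (l + k)) *\<^sub>R z"
      have coeff: "l / (l + k) \<ge> 0" "k / (l + k) \<ge> 0" "l / (l + k) + k / (l + k) = 1"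
        using ly kz pos by (auto simp flip: add_divide_distrib)
      have "x \<in> D"
        unfolding x_def using convex_on_imp_convex[OF g] ly(2) kz(2) coeff by (rule convexD)
      moreover have "(l + k) *\<^sub>R x = l *\<^sub>R y + k *\<^sub>R z"
        using pos by (simp add: x_def scaleR_add_right)
      moreover have "g x \<le> l / (l + k) * g y + k / (l + k) * g z"
        unfolding x_def using g ly(2) kz(2) coeff unfolding convex_on_def by blast
      then have "(l + k) * g x \<le> l * g y + k * g z"
        using pos by (simp add: pos_le_divide_eq mult.commute flip: add_divide_distrib)
      ultimately show thesis by (rule that)
    qed
    have "(v + w) - (l + k) *\<^sub>R (x - z0) = (v - l *\<^sub>R (y - z0)) + (w - k *\<^sub>R (z - z0))"
      using x(2) by (simp add: algebra_simps)
    then have "q ((v + w) - (l + k) *\<^sub>R (x - z0)) \<le> q (v - l *\<^sub>R (y - z0)) + q (w - k *\<^sub>R (z - z0))"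
      by (metis sublinear_add[OF q])
    then have "(l + k) * (g x - s) + q ((v + w) - (l + k) *\<^sub>R (x - z0)) \<le> a + b"
      using x(3) ly(3) kz(3) unfolding right_diff_distrib distrib_right by linarith
    then show "a + b \<in> R (v + w)"
      using ly(1) kz(1) x(1) unfolding R_def by (intro CollectI exI[of _ "l + k"]) auto
  next
    fix c :: real and v a assume c: "c > 0" and "a \<in> R v"
    then obtain l z where lz: "l \<ge> 0" "z \<in> D" "l * (g z - s) + q (v - l *\<^sub>R (z - z0)) \<le> a"
      by (auto simp: R_def)
    have "(c * l) * (g z - s) + q (c *\<^sub>R v - (c * l) *\<^sub>R (z - z0))
        = c * (l * (g z - s) + q (v - l *\<^sub>R (z - z0)))"
      using sublinear_scale_pos[OF q c, of "v - l *\<^sub>R (z - z0)"]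
      by (simp add: scaleR_diff_right distrib_left)
    also have "\<dots> \<le> c * a" using c lz by simp
    finally show "c * a \<in> R (c *\<^sub>R v)"
      using lz c unfolding R_def by (intro CollectI exI[of _ "c * l"]) auto
  qed (use mem[OF _ z1, of 0] in auto)
  then obtain f where f: "linear f" "\<And>v. f v \<le> Inf (R v)"
    using hahn_banach by blast
  have fR: "f v \<le> l * (g z - s) + q (v - l *\<^sub>R (z - z0))" if "l \<ge> 0" "z \<in> D" for l z v
    using f(2)[of v] cInf_lower[OF mem[OF that, of v] bdd] by linarith
  \<comment> \<open>The choice \<open>l = 0\<close> gives the bound by \<open>q\<close>;
    \<open>l = 1\<close> and \<open>v = z - z0\<close> give the affine minorant of
    \<open>g\<close>.\<close>
  show thesis
  proof (rule that[OF f(1)])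
    show "f v \<le> q v" for v using fR[OF _ z1, of 0 v] by simp
    show "s + f (z - z0) \<le> g z" if "z \<in> D" for z
      using fR[OF _ that, of 1 "z - z0"] by (simp add: sublinear_zero[OF q])
  qed
qed

section \<open>Gauges and cone minorants of convex functions\<close>

definition minkowski_gauge :: "'b::real_vector set \<Rightarrow> 'b \<Rightarrow> real" where
  "minkowski_gauge V x = Inf {t. t > 0 \<and> x /\<^sub>R t \<in> V}"

text \<open>These are the algebraic properties of a neighbourhood of 0 that make its gauge a finite
  seminorm, which keeps the estimates for convex functions free of topology.\<close>

locale absorbing_disc =
  fixes V :: "'b::real_vector set"
  assumes convex: "convex V" and zero: "0 \<in> V"
    and symmetric: "\<And>x. x \<in> V \<Longrightarrow> - x \<in> V"
    and absorbing: "\<And>x. \<exists>t>0. x /\<^sub>R t \<in> V"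
begin

lemma bdd_below_gauge_set: "bdd_below {t. t > 0 \<and> x /\<^sub>R t \<in> V}"
  by (rule bdd_belowI[of _ 0]) auto

lemma gauge_le: "t > 0 \<Longrightarrow> x /\<^sub>R t \<in> V \<Longrightarrow> minkowski_gauge V x \<le> t"
  unfolding minkowski_gauge_def by (rule cInf_lower[OF _ bdd_below_gauge_set]) simp

lemma gauge_nonneg: "minkowski_gauge V x \<ge> 0"
  unfolding minkowski_gauge_def by (rule cInf_greatest) (use absorbing in auto)

lemma gauge_uminus: "minkowski_gauge V (- x) = minkowski_gauge V x"
  unfolding minkowski_gauge_def using symmetric
  by (intro arg_cong[where f = Inf] Collect_cong) (metis minus_minus scaleR_minus_right)

lemma sublinear_gauge: "sublinear (minkowski_gauge V)"
  unfolding minkowski_gauge_def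
proof (rule sublinear_Inf_fibres[OF _ _ _ bdd_below_gauge_set])
  fix x y s t
  assume "s \<in> {t. t > 0 \<and> x /\<^sub>R t \<in> V}" "t \<in> {t. t > 0 \<and> y /\<^sub>R t \<in> V}"
  then have st: "s > 0" "t > 0" "x /\<^sub>R s \<in> V" "y /\<^sub>R t \<in> V" by auto
  have "(s / (s + t)) *\<^sub>R (x /\<^sub>R s) + (t / (s + t)) *\<^sub>R (y /\<^sub>R t) \<in> V"
    using st by (intro convexD[OF convex]) (auto simp flip: add_divide_distrib)
  moreover have "s / (s + t) * inverse s = inverse (s + t)" "t / (s + t) * inverse t = inverse (s + t)"
    using st by (simp_all add: field_simps)
  then have "(s / (s + t)) *\<^sub>R (x /\<^sub>R s) + (t / (s + t)) *\<^sub>R (y /\<^sub>R t) = (x + y) /\<^sub>R (s + t)"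
    by (simp only: scaleR_scaleR scaleR_add_right)
  ultimately show "s + t \<in> {t. t > 0 \<and> (x + y) /\<^sub>R t \<in> V}" using st by simp
next
  fix c :: real and x t assume c: "c > 0" and "t \<in> {t. t > 0 \<and> x /\<^sub>R t \<in> V}"
  then show "c * t \<in> {t. t > 0 \<and> (c *\<^sub>R x) /\<^sub>R t \<in> V}" by (simp add: field_simps)
qed (use absorbing in auto)

lemma gauge_less_one:
  assumes "minkowski_gauge V x < 1"
  shows "x \<in> V"
proof -
  obtain t where t: "t > 0" "x /\<^sub>R t \<in> V" "t < 1"
    using assms absorbing[of x]
    unfolding minkowski_gauge_def by (subst (asm) cInf_less_iff[OF _ bdd_below_gauge_set]) auto
  have "t *\<^sub>R (x /\<^sub>R t) + (1 - t) *\<^sub>R 0 \<in> V"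
    using t zero by (intro convexD[OF convex]) auto
  then show ?thesis using t by simp
qed

text \<open>If \<open>g\<close> fell too steeply away from \<open>z1\<close>, convexity along the
  segment to a far point \<open>z\<close> would force \<open>g\<close> below \<open>r\<close> at a
  point of the segment still inside \<open>z1 + V\<close>.\<close>

lemma convex_cone_minorant_at_domain:
  assumes g: "convex_on D g" and z1: "z1 \<in> D"
    and r: "\<And>z. z \<in> D \<Longrightarrow> z - z1 \<in> V \<Longrightarrow> r \<le> g z"
  shows "\<exists>K\<ge>0. \<forall>z\<in>D. r - K * minkowski_gauge V (z - z1) \<le> g z"
proof (intro exI[of _ "2 * (g z1 - r)"] conjI ballI)
  have r1: "r \<le> g z1" using r[OF z1] zero by simp
  then show "0 \<le> 2 * (g z1 - r)" by simp
  fix z assume z: "z \<in> D"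
  define t where "t = minkowski_gauge V (z - z1)"
  have "r - 2 * (g z1 - r) * t \<le> g z"
  proof (cases "t < 1")
    case True
    then have "r \<le> g z" using r[OF z] gauge_less_one by (simp add: t_def)
    moreover have "0 \<le> 2 * (g z1 - r) * t" using r1 gauge_nonneg by (simp add: t_def)
    ultimately show ?thesis by linarith
  next
    case False
    \<comment> \<open>This places \<open>y\<close> at gauge distance 1/2 from \<open>z1\<close>,
      safely inside \<open>z1 + V\<close>; the 1/2 is the origin of the factor 2 in the
      slope.\<close>
    define l where "l = 1 / (2 * t)"
    have l: "0 \<le> l" "l \<le> 1" "l * t = 1 / 2" using False by (auto simp: l_def)
    define y where "y = (1 - l) *\<^sub>R z1 + l *\<^sub>R z"
    have "y - z1 = l *\<^sub>R (z - z1)" by (simp add: y_def algebra_simps)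
    then have "minkowski_gauge V (y - z1) < 1"
      using l by (simp add: sublinear_scale[OF sublinear_gauge] t_def)
    moreover have "y \<in> D"
      unfolding y_def using convex_on_imp_convex[OF g] z1 z l by (simp add: convexD_alt)
    ultimately have "r \<le> g y" using r gauge_less_one by blast
    also have "g y \<le> (1 - l) * g z1 + l * g z"
      unfolding y_def using convex_onD[OF g] l z1 z by blast
    finally have "2 * t * r \<le> 2 * t * ((1 - l) * g z1 + l * g z)"
      using False by (intro mult_left_mono) auto
    also have "\<dots> = 2 * t * g z1 - 2 * (l * t) * g z1 + 2 * (l * t) * g z"
      by (simp add: algebra_simps)
    finally have "2 * t * r \<le> 2 * t * g z1 - g z1 + g z" by (simp add: l(3))
    then show ?thesis using r1 by (simp add: algebra_simps)
  qed
  then show "r - 2 * (g z1 - r) * minkowski_gauge V (z - z1) \<le> g z" by (simp add: t_def)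
qed

text \<open>The point \<open>z0\<close> need not belong to the domain: away from \<open>z0\<close> the cone with apex at a domain
  point \<open>z1\<close> is used, and its slope is increased until it also lies below \<open>r\<close> there.\<close>

lemma convex_cone_minorant:
  assumes g: "convex_on D g" and z1: "z1 \<in> D"
    and r1: "\<And>z. z \<in> D \<Longrightarrow> z - z1 \<in> V \<Longrightarrow> r1 \<le> g z"
    and r: "\<And>z. z \<in> D \<Longrightarrow> z - z0 \<in> V \<Longrightarrow> r \<le> g z"
  shows "\<exists>K\<ge>0. \<forall>z\<in>D. r - K * minkowski_gauge V (z - z0) \<le> g z"
proof -
  let ?q = "minkowski_gauge V"
  obtain K1 where K1: "K1 \<ge> 0" "\<And>z. z \<in> D \<Longrightarrow> r1 - K1 * ?q (z - z1) \<le> g z"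
    using convex_cone_minorant_at_domain[OF g z1 r1] by blast
  \<comment> \<open>\<open>M\<close> covers the gap between \<open>r\<close> and the cone at
    \<open>z1\<close> after its apex is moved to \<open>z0\<close>. Where the gauge of
    \<open>z - z0\<close> is at least 1, the additional slope \<open>M\<close> pays for that
    gap.\<close>
  define M where "M = \<bar>r - r1 + K1 * ?q (z0 - z1)\<bar>"
  have M: "r - r1 + K1 * ?q (z0 - z1) \<le> M" by (simp add: M_def)
  show ?thesis
  proof (intro exI[of _ "K1 + M"] conjI ballI)
    show "0 \<le> K1 + M" using K1(1) by (simp add: M_def)
    fix z assume z: "z \<in> D"
    show "r - (K1 + M) * ?q (z - z0) \<le> g z"
    proof (cases "?q (z - z0) < 1")
      case True
      have "0 \<le> (K1 + M) * ?q (z - z0)" using K1(1) gauge_nonneg by (simp add: M_def)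
      then show ?thesis using r[OF z gauge_less_one[OF True]] by linarith
    next
      case False
      have "?q (z - z1) \<le> ?q (z - z0) + ?q (z0 - z1)"
        using sublinear_add[OF sublinear_gauge, of "z - z0" "z0 - z1"] by simp
      then have "K1 * ?q (z - z1) \<le> K1 * ?q (z - z0) + K1 * ?q (z0 - z1)"
        using K1(1) by (metis distrib_left mult_left_mono)
      moreover have "M * 1 \<le> M * ?q (z - z0)"
        using False by (intro mult_left_mono) (auto simp: M_def)
      ultimately show ?thesis
        using K1(2)[OF z] M unfolding distrib_right by linarith
    qed
  qed
qed

end

section \<open>Continuous affine minorants\<close>

lemma locally_convex_translation:
  assumes T: "locally_convex_topology T" and U: "openin T U"
  shows "openin T {v. z + v \<in> U}"
proof -
  have top: "topspace T = UNIV" using T by (simp add: locally_convex_topology_def)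
  have "continuous_map T (prod_topology T T) (\<lambda>v. (z, v))"
    using top by (simp add: continuous_map_pairwise comp_def)
  then have "continuous_map T T (\<lambda>v. z + v)"
    using T continuous_map_compose[of T _ "\<lambda>v. (z, v)" T "\<lambda>(z, w). z + w"]
    by (simp add: locally_convex_topology_def comp_def)
  from openin_continuous_map_preimage[OF this U] show ?thesis by (simp add: top)
qed

lemma locally_convex_scaling:
  assumes T: "locally_convex_topology T" and U: "openin T U"
  shows "openin T {v. c *\<^sub>R v \<in> U}"
proof -
  have top: "topspace T = UNIV" using T by (simp add: locally_convex_topology_def)
  have "continuous_map T (prod_topology euclideanreal T) (\<lambda>v. (c, v))"
    using top by (simp add: continuous_map_pairwise comp_def)
  then have "continuous_map T T (\<lambda>v. c *\<^sub>R v)"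
    using T continuous_map_compose[of T _ "\<lambda>v. (c, v)" T "\<lambda>(c, z). c *\<^sub>R z"]
    by (simp add: locally_convex_topology_def comp_def)
  from openin_continuous_map_preimage[OF this U] show ?thesis by (simp add: top)
qed

text \<open>Intersecting a convex neighbourhood with its reflection makes it symmetric; it is
  absorbing because scalar multiplication is continuous in the scalar at 0.\<close>

lemma locally_convex_disc:
  assumes T: "locally_convex_topology T" and U: "openin T U" "0 \<in> U"
  obtains V where "openin T V" "absorbing_disc V" "V \<subseteq> U"
proof -
  obtain W where W: "openin T W" "convex W" "0 \<in> W" "W \<subseteq> U"
    using T U unfolding locally_convex_topology_def by blast
  have top: "topspace T = UNIV" using T by (simp add: locally_convex_topology_def)
  define V where "V = W \<inter> {v. (- 1) *\<^sub>R v \<in> W}"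
  have "openin T V"
    unfolding V_def using W(1) locally_convex_scaling[OF T W(1)] by (rule openin_Int)
  moreover have "absorbing_disc V"
  proof
    have "{v. (- 1) *\<^sub>R v \<in> W} = (\<lambda>v. (- 1) *\<^sub>R v) -` W" by auto
    then show "convex V"
      unfolding V_def using W(2)
      by (simp only: convex_Int convex_linear_vimage module_hom_scale_self)
    show "0 \<in> V" using W(3) by (simp add: V_def)
    show "- x \<in> V" if "x \<in> V" for x using that by (simp add: V_def)
    show "\<exists>t>0. x /\<^sub>R t \<in> V" for x
    proof -
      have "continuous_map euclideanreal (prod_topology euclideanreal T) (\<lambda>c. (c, x))"
        using top by (simp add: continuous_map_pairwise comp_def)
      then have "continuous_map euclideanreal T (\<lambda>c. c *\<^sub>R x)"
        using T continuous_map_compose[of euclideanreal _ "\<lambda>c. (c, x)" T "\<lambda>(c, z). c *\<^sub>R z"]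
        by (simp add: locally_convex_topology_def comp_def)
      from openin_continuous_map_preimage[OF this \<open>openin T V\<close>]
      have "open {c. c *\<^sub>R x \<in> V}" by simp
      moreover have "0 \<in> {c. c *\<^sub>R x \<in> V}" using \<open>0 \<in> V\<close> by simp
      ultimately obtain e where e: "e > 0" "ball 0 e \<subseteq> {c. c *\<^sub>R x \<in> V}"
        by (meson open_contains_ball)
      have "e / 2 \<in> ball 0 e" using e(1) by simp
      then have "(e / 2) *\<^sub>R x \<in> V" using e(2) by blast
      then show ?thesis using e(1) by (intro exI[of _ "2 / e"]) simp
    qed
  qed
  moreover have "V \<subseteq> U" using W(4) by (auto simp: V_def)
  ultimately show thesis by (rule that)
qed

lemma continuous_map_linear_bounded_nhd:
  fixes f :: "'b::real_vector \<Rightarrow> real"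
  assumes T: "locally_convex_topology T" and V: "openin T V" "0 \<in> V"
    and f: "linear f" and bound: "\<And>v. v \<in> V \<Longrightarrow> \<bar>f v\<bar> \<le> K"
  shows "continuous_map T euclideanreal f"
proof -
  have top: "topspace T = UNIV" using T by (simp add: locally_convex_topology_def)
  have "openin T {x. f x \<in> W}" if W: "open W" for W
  proof (subst openin_subopen, intro ballI)
    fix x assume "x \<in> {x. f x \<in> W}"
    then obtain e where e: "e > 0" "ball (f x) e \<subseteq> W"
      using W by (auto simp: open_contains_ball)
    \<comment> \<open>The added 1 makes \<open>c\<close> positive even for \<open>K = 0\<close> and
      gives the strict inequality \<open>K < c * e\<close>.\<close>
    define c where "c = (\<bar>K\<bar> + 1) / e"
    have c: "c > 0" using e(1) by (simp add: c_def)
    define N where "N = {y. - x + y \<in> {v. c *\<^sub>R v \<in> V}}"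
    have "openin T N"
      unfolding N_def
      by (intro locally_convex_translation[OF T] locally_convex_scaling[OF T] V(1))
    moreover have "x \<in> N" using V(2) by (simp add: N_def)
    moreover have "f y \<in> W" if "y \<in> N" for y
    proof -
      have "\<bar>f (c *\<^sub>R (- x + y))\<bar> \<le> K" using that bound by (simp add: N_def)
      then have "c * \<bar>f y - f x\<bar> \<le> K"
        using c by (simp add: linear_scale[OF f] linear_diff[OF f] abs_mult)
      also have "K < c * e" using e(1) by (simp add: c_def)
      finally have "\<bar>f y - f x\<bar> < e" using c by simp
      then show ?thesis using e(2) by (force simp: dist_real_def)
    qed
    ultimately show "\<exists>N. openin T N \<and> x \<in> N \<and> N \<subseteq> {x. f x \<in> W}" by blast
  qed
  then show ?thesis by (simp add: continuous_map_def top)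
qed

text \<open>The sandwich theorem concerns real functions, so \<open>h\<close> is restricted to its
  effective domain, where properness makes its values finite.\<close>

lemma convex_on_real_of_ereal:
  assumes "proper_fun h" "convex_fun h"
  shows "convex_on {z. h z \<noteq> \<infinity>} (\<lambda>z. real_of_ereal (h z))"
proof -
  let ?g = "\<lambda>z. real_of_ereal (h z)"
  have fin: "h z = ereal (?g z)" if "h z \<noteq> \<infinity>" for z
    using assms(1) that by (cases "h z") (auto simp: proper_fun_def)
  have le: "h (u *\<^sub>R x + v *\<^sub>R y) \<le> ereal (u * ?g x + v * ?g y)"
    if "h x \<noteq> \<infinity>" "h y \<noteq> \<infinity>" "0 \<le> u" "0 \<le> v" "u + v = 1" for x y u v
  proof -
    have "h (u *\<^sub>R x + v *\<^sub>R y) \<le> ereal u * h x + ereal v * h y"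
      using assms(2) that unfolding convex_fun_def by blast
    then show ?thesis using fin[OF that(1)] fin[OF that(2)]
      by (metis plus_ereal.simps(1) times_ereal.simps(1))
  qed
  then have dom: "h (u *\<^sub>R x + v *\<^sub>R y) \<noteq> \<infinity>"
    if "h x \<noteq> \<infinity>" "h y \<noteq> \<infinity>" "0 \<le> u" "0 \<le> v" "u + v = 1" for x y u v
    using that by fastforce
  then have "convex {z. h z \<noteq> \<infinity>}" by (auto simp: convex_def)
  moreover have "?g (u *\<^sub>R x + v *\<^sub>R y) \<le> u * ?g x + v * ?g y"
    if "h x \<noteq> \<infinity>" "h y \<noteq> \<infinity>" "0 \<le> u" "0 \<le> v" "u + v = 1" for x y u v
    using le[OF that] fin[OF dom[OF that]] by (metis ereal_less_eq(3))
  ultimately show ?thesis by (simp add: convex_on_def)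
qed

text \<open>This is the nontrivial half of the Fenchel-Moreau theorem.\<close>

lemma continuous_affine_minorant:
  fixes h :: "'b::real_vector \<Rightarrow> ereal"
  assumes T: "locally_convex_topology T"
    and h: "proper_fun h" "convex_fun h" "lsc_fun T h" and r: "ereal r < h z0"
  obtains f where "linear f" "continuous_map T euclideanreal f"
    "\<And>z. ereal (r + f (z - z0)) \<le> h z"
proof -
  define D where "D = {z. h z \<noteq> \<infinity>}"
  define g where "g z = real_of_ereal (h z)" for z
  have hg: "h z = ereal (g z)" if "z \<in> D" for z
    using h(1) that by (cases "h z") (auto simp: proper_fun_def D_def g_def)
  have g: "convex_on D g"
    using convex_on_real_of_ereal[OF h(1,2)] by (simp add: D_def g_def[abs_def])
  obtain z1 where z1: "z1 \<in> D" using h(1) by (auto simp: proper_fun_def D_def)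
  have top: "topspace T = UNIV" using T by (simp add: locally_convex_topology_def)
  have op: "openin T {v. z + v \<in> {z. ereal s < h z}}" for z s
    using h(3) by (intro locally_convex_translation[OF T]) (simp add: lsc_fun_def top)
  \<comment> \<open>Lower semicontinuity is used at two points: near \<open>z0\<close> to keep
    \<open>h\<close> above \<open>r\<close>, and near the domain point \<open>z1\<close>, since
    \<open>h z0\<close> may be infinite and the cone estimate must start from a finite
    value.\<close>
  define U where
    "U = {v. z0 + v \<in> {z. ereal r < h z}} \<inter> {v. z1 + v \<in> {z. ereal (g z1 - 1) < h z}}"
  have "openin T U" unfolding U_def by (intro openin_Int op)
  moreover have "0 \<in> U" using r hg[OF z1] by (simp add: U_def)
  ultimately obtain V where V: "openin T V" "absorbing_disc V" "V \<subseteq> U"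
    by (rule locally_convex_disc[OF T])
  interpret absorbing_disc V by fact
  have "\<exists>K\<ge>0. \<forall>z\<in>D. r - K * minkowski_gauge V (z - z0) \<le> g z"
  proof (rule convex_cone_minorant[OF g z1])
    fix z assume z: "z \<in> D" "z - z1 \<in> V"
    then have "z - z1 \<in> U" using V(3) by blast
    then show "g z1 - 1 \<le> g z" using hg[OF z(1)] by (simp add: U_def)
  next
    fix z assume z: "z \<in> D" "z - z0 \<in> V"
    then have "z - z0 \<in> U" using V(3) by blast
    then show "r \<le> g z" using hg[OF z(1)] by (simp add: U_def)
  qed
  then obtain K where K: "K \<ge> 0" "\<And>z. z \<in> D \<Longrightarrow> r - K * minkowski_gauge V (z - z0) \<le> g z"
    by blast
  have sub: "sublinear (\<lambda>x. K * minkowski_gauge V x)"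
    using sublinear_gauge K(1) by (rule sublinear_scaled)
  have "r \<le> g z + K * minkowski_gauge V (z0 - z)" if "z \<in> D" for z
    using K(2)[OF that] gauge_uminus[of "z - z0"] by simp
  then obtain f where f: "linear f" "\<And>v. f v \<le> K * minkowski_gauge V v"
    "\<And>z. z \<in> D \<Longrightarrow> r + f (z - z0) \<le> g z"
    using hahn_banach_sandwich[OF g _ sub] z1 by blast
  have up: "f v \<le> K" if "v \<in> V" for v
  proof -
    have "K * minkowski_gauge V v \<le> K * 1"
      using K(1) gauge_le[of 1 v] that by (intro mult_left_mono) auto
    then show ?thesis using f(2)[of v] by simp
  qed
  \<comment> \<open>Domination by the gauge bounds \<open>f\<close> only from above; symmetry of
    \<open>V\<close> supplies the other side.\<close>
  have "\<bar>f v\<bar> \<le> K" if "v \<in> V" for v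
    using up[OF that] up[OF symmetric[OF that]] by (simp add: linear_neg[OF f(1)])
  then have "continuous_map T euclideanreal f"
    by (rule continuous_map_linear_bounded_nhd[OF T V(1) zero f(1)])
  moreover have "ereal (r + f (z - z0)) \<le> h z" for z
    using f(3)[of z] hg[of z] by (cases "z \<in> D") (auto simp: D_def)
  ultimately show thesis using that f(1) by blast
qed

section \<open>The Penot function\<close>

lemma pairing_commute: "pairing z w = pairing w z"
  by (simp add: pairing_def)

lemma linear_pairing: "linear (\<lambda>z. pairing z w)"
  by (intro linearI) (simp_all add: pairing_def blinfun.add_left blinfun.add_right
      blinfun.scaleR_left blinfun.scaleR_right algebra_simps)

lemma convex_fun_conjugate: "convex_fun (conjugate_fun f)"
  unfolding convex_fun_def
proof (intro allI impI)
  fix x y and u v :: real assume uv: "0 \<le> u" "0 \<le> v" "u + v = 1"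
  let ?k = "conjugate_fun f"
  show "?k (u *\<^sub>R x + v *\<^sub>R y) \<le> ereal u * ?k x + ereal v * ?k y"
    unfolding conjugate_fun_def[of f "u *\<^sub>R x + v *\<^sub>R y"]
  proof (rule SUP_least)
    fix z
    have p: "pairing (u *\<^sub>R x + v *\<^sub>R y) z = u * pairing x z + v * pairing y z"
      by (simp add: linear_add[OF linear_pairing] linear_scale[OF linear_pairing])
    have le: "ereal (pairing w z) - f z \<le> ?k w" for w
      unfolding conjugate_fun_def by (rule SUP_upper) simp
    have "ereal (pairing (u *\<^sub>R x + v *\<^sub>R y) z) - f z
        = ereal u * (ereal (pairing x z) - f z) + ereal v * (ereal (pairing y z) - f z)"
    \<comment> \<open>At an infinite value of \<open>f\<close> both differences are the same
      infinity, and since \<open>u + v = 1\<close> at least one weight is positive and preserves it;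
      a zero weight contributes 0.\<close>
    proof (cases "f z")
      case (real a)
      have "a = u * a + v * a" using uv(3) by (simp flip: distrib_right)
      then show ?thesis using real p by (simp add: algebra_simps)
    next
      case PInf
      then show ?thesis using uv by (cases "u = 0"; cases "v = 0") auto
    next
      case MInf
      then show ?thesis using uv by (cases "u = 0"; cases "v = 0") auto
    qed
    also have "\<dots> \<le> ereal u * ?k x + ereal v * ?k y"
      using uv le by (intro add_mono ereal_mult_left_mono) auto
    finally show "ereal (pairing (u *\<^sub>R x + v *\<^sub>R y) z) - f z
        \<le> ereal u * ?k x + ereal v * ?k y" .
  qed
qed

text \<open>A strict superlevel set of a supremum is the union of those of its terms; here each is
  an open half-space, empty or everything.\<close>

lemma lsc_fun_conjugate:
  assumes "duality_compatible T"
  shows "lsc_fun T (conjugate_fun f)"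
  unfolding lsc_fun_def
proof
  fix r :: real
  have top: "topspace T = UNIV"
    using assms by (simp add: duality_compatible_def locally_convex_topology_def)
  have cont: "continuous_map T euclideanreal (\<lambda>w. pairing w z)" for z
    using assms linear_pairing unfolding duality_compatible_def by blast
  have "openin T {w. ereal r < ereal (pairing w z) - f z}" for z
  proof (cases "f z")
    case (real a)
    have "openin T {w \<in> topspace T. pairing w z \<in> {r + a<..}}"
      using cont by (rule openin_continuous_map_preimage) simp
    moreover have "(ereal r < ereal (pairing w z) - f z) \<longleftrightarrow> r + a < pairing w z" for w
      using real by auto
    ultimately show ?thesis by (simp add: top)
  qed (use openin_topspace[of T] in \<open>simp_all add: top\<close>)
  then have "openin T (\<Union>z. {w. ereal r < ereal (pairing w z) - f z})" by blast
  moreover have "{w \<in> topspace T. ereal r < conjugate_fun f w}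
      = (\<Union>z. {w. ereal r < ereal (pairing w z) - f z})"
    by (auto simp: conjugate_fun_def less_SUP_iff top)
  ultimately show "openin T {w \<in> topspace T. ereal r < conjugate_fun f w}" by simp
qed

section \<open>Upper and lower bounds for the Penot function\<close>

lemma penot_fun_le_duality:
  assumes "a \<in> A"
  shows "penot_fun A a \<le> ereal (duality a)"
  unfolding penot_fun_def conjugate_fun_def
proof (rule SUP_least)
  fix z
  have "ereal (pairing z a - duality a) \<le> fitzpatrick_fun A z"
    unfolding fitzpatrick_fun_eq using assms by (rule SUP_upper)
  then show "ereal (pairing a z) - fitzpatrick_fun A z \<le> ereal (duality a)"
    by (cases "fitzpatrick_fun A z") (auto simp: pairing_commute[of a])
qed

text \<open>Each real \<open>r\<close> below \<open>h z\<close> comes with an affine minorant of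
  \<open>h\<close> with value \<open>r\<close> at \<open>z\<close>, and compatibility represents its
  slope by some \<open>w\<close>. Comparison on \<open>A\<close> bounds the Fitzpatrick function at
  \<open>w\<close> by \<open>pairing z w - r\<close>, so the term for \<open>w\<close> in the
  conjugate is at least \<open>r\<close>.\<close>

lemma convex_lsc_minorant_le_penot_fun:
  assumes T: "duality_compatible T"
    and h: "proper_fun h" "convex_fun h" "lsc_fun T h"
    and le: "\<And>a. a \<in> A \<Longrightarrow> h a \<le> ereal (duality a)"
  shows "h z \<le> penot_fun A z"
proof (rule dense_le)
  fix y assume "y < h z"
  show "y \<le> penot_fun A z"
  proof (cases y)
    case (real r)
    obtain f where f: "linear f" "continuous_map T euclideanreal f"
      "\<And>x. ereal (r + f (x - z)) \<le> h x"
    proof (rule continuous_affine_minorant[OF _ h])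
      show "locally_convex_topology T" using T by (simp add: duality_compatible_def)
      show "ereal r < h z" using \<open>y < h z\<close> real by simp
    qed blast
    then obtain w where w: "\<And>x. f x = pairing x w"
      using T unfolding duality_compatible_def by metis
    have "fitzpatrick_fun A w \<le> ereal (pairing z w - r)"
      unfolding fitzpatrick_fun_eq
    proof (rule SUP_least)
      fix a assume "a \<in> A"
      then have "ereal (r + f (a - z)) \<le> ereal (duality a)" using f(3) le order_trans by blast
      then show "ereal (pairing w a - duality a) \<le> ereal (pairing z w - r)"
        by (simp add: linear_diff[OF linear_pairing] w pairing_commute[of w])
    qed
    then have "ereal r \<le> ereal (pairing z w) - fitzpatrick_fun A w"
      by (cases "fitzpatrick_fun A w") auto
    also have "\<dots> \<le> penot_fun A z"
      unfolding penot_fun_def conjugate_fun_def by (rule SUP_upper) simp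
    finally show ?thesis by (simp add: real)
  qed (use \<open>y < h z\<close> in auto)
qed

theorem theorem3p2:
  fixes T :: "('a::banach \<times> ('a \<Rightarrow>\<^sub>L real)) topology"
    and A :: "('a \<times> ('a \<Rightarrow>\<^sub>L real)) set"
  assumes "duality_compatible T"
    and "A \<noteq> {}"
  shows "representable T A \<longleftrightarrow> representative T (penot_fun A) A"
proof
  assume "representative T (penot_fun A) A"
  then show "representable T A" by (auto simp: representable_def)
next
  assume "representable T A"
  then obtain h where h: "proper_fun h" "convex_fun h" "lsc_fun T h"
    "\<And>z. ereal (duality z) \<le> h z" "\<And>z. z \<in> A \<longleftrightarrow> h z = ereal (duality z)"
    by (auto simp: representable_def representative_def)
  have hp: "h z \<le> penot_fun A z" for z
    using assms(1) h(1-3) by (rule convex_lsc_minorant_le_penot_fun) (simp add: h(5))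
  have ge: "ereal (duality z) \<le> penot_fun A z" for z
    using h(4) hp by (rule order_trans)
  \<comment> \<open>On \<open>A\<close> the Penot function lies between the duality and itself;
    conversely, equality for the Penot function squeezes \<open>h z\<close> to the duality, which
    puts \<open>z\<close> in \<open>A\<close>.\<close>
  have iff: "z \<in> A \<longleftrightarrow> penot_fun A z = ereal (duality z)" for z
    using penot_fun_le_duality[of z A] ge[of z] hp[of z] h(4,5)[of z] by (metis antisym)
  \<comment> \<open>A point of \<open>A\<close> is where the Penot function is finite; the bound
    \<open>ge\<close> excludes minus infinity everywhere.\<close>
  obtain a where "a \<in> A" using assms(2) by blast
  then have "proper_fun (penot_fun A)"
    unfolding proper_fun_def using ge iff[of a] by (metis MInfty_neq_ereal(1) PInfty_neq_ereal(1) ereal_infty_less_eq(2))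
  moreover have "convex_fun (penot_fun A)" "lsc_fun T (penot_fun A)"
    unfolding penot_fun_def by (rule convex_fun_conjugate lsc_fun_conjugate[OF assms(1)])+
  ultimately show "representative T (penot_fun A) A"
    using ge iff by (simp add: representative_def)
qed

end
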